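(* Let $X$ and $Y$ be normed spaces and $T\in LR(X,Y)$. If $T$ is bounded and $T(0)$ is closed, then $T$ is closable. Further, if in addition $Y$ is complete, then $$D(\overline T)=\overline{D(T)},$$ and $\overline T$ is the bounded extension of $T$ onto $\overline{D(T)}$ with bound $\|T\|$ (that is, $\overline T$ extends $T$, is bounded, and $\|\overline T\|=\|T\|$).
   Context: All spaces are over the same scalar field ($\mathbf R$ or $\mathbf C$). $LR(X,Y)$ is the set of all linear subspaces of $X\times Y$. For $T\in LR(X,Y)$: $D(T)$ is its domain, $T(x)=\{y\in Y:(x,y)\in T\}$. $\overline T$ is the closure of $T$ in $X\times Y$; $T$ is closable if $\overline T(x)=T(x)$ for each $x\in D(T)$. A subspace $S\in LR(X,Y)$ is an extension of $T$ if $D(T)\subset D(S)$ and $S(x)=T(x)$ for all $x\in D(T)$. For $x\in D(T)$, $\|T(x)\|:=\|[y]\|$ for any $y\in T(x)$, where $[y]=y+\overline{T(0)}\in Y/\overline{T(0)}$ and $\|[y]\|=\inf\{\|y-e\|:e\in\overline{T(0)}\}$. $\|T\|:=\sup\{\|T(x)\|:x\in D(T),\ \|x\|\le1\}$, and $T$ is bounded if $\|T\|<\infty$. *)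

theory Defs
  imports "HOL-Analysis.Analysis"
begin

text \<open>
  Up to isomorphism the types of class \<open>real_normed_field\<close> are exactly the real and the complex
  numbers (Gelfand-Mazur), so a type variable of that class stands for the common scalar field.
  A normed space is a type of class \<open>real_normed_vector\<close>, which supplies the norm and the topology,
  together with a scalar multiplication. The last axiom says that the real scalar multiplication of
  the type class is the restriction of \<open>scale\<close>.
\<close>

locale normed_space = vector_space scale
  for scale :: "'k::real_normed_field \<Rightarrow> 'a::real_normed_vector \<Rightarrow> 'a" +
  assumes norm_scale: "norm (scale c x) = norm c * norm x"
    and scale_of_real: "scale (of_real r) x = r *\<^sub>R x"

lemma normed_space_real: "normed_space (scaleR :: real \<Rightarrow> 'a \<Rightarrow> 'a::real_normed_vector)"
  by unfold_locales (simp_all add: scaleR_add_left scaleR_add_right)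

lemma normed_space_complex: "normed_space ((*) :: complex \<Rightarrow> complex \<Rightarrow> complex)"
  by unfold_locales (simp_all add: ring_distribs norm_mult scaleR_conv_of_real)

text \<open>
  For a relation \<open>T\<close>, the domain is \<open>Domain T\<close>, the set of values at \<open>x\<close> is the image \<open>T `` {x}\<close>,
  and the closure of \<open>T\<close> is \<open>closure T\<close> in the product topology.
\<close>

definition LR ::
  "('k::real_normed_field \<Rightarrow> 'a::real_normed_vector \<Rightarrow> 'a) \<Rightarrow>
   ('k \<Rightarrow> 'b::real_normed_vector \<Rightarrow> 'b) \<Rightarrow> ('a \<times> 'b) set set"
  where "LR sX sY = {T. module.subspace (module_prod.scale sX sY) T}"

definition closable :: "('a::real_normed_vector \<times> 'b::real_normed_vector) set \<Rightarrow> bool"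
  where "closable T \<longleftrightarrow> (\<forall>x\<in>Domain T. closure T `` {x} = T `` {x})"

definition is_extension ::
  "('k::real_normed_field \<Rightarrow> 'a::real_normed_vector \<Rightarrow> 'a) \<Rightarrow>
   ('k \<Rightarrow> 'b::real_normed_vector \<Rightarrow> 'b) \<Rightarrow> ('a \<times> 'b) set \<Rightarrow> ('a \<times> 'b) set \<Rightarrow> bool"
  where "is_extension sX sY S T \<longleftrightarrow>
    S \<in> LR sX sY \<and> Domain T \<subseteq> Domain S \<and> (\<forall>x\<in>Domain T. S `` {x} = T `` {x})"

text \<open>The norm of the class of \<open>y\<close> in the quotient by \<open>E\<close>.\<close>

definition quotient_norm :: "'b::real_normed_vector set \<Rightarrow> 'b \<Rightarrow> real"
  where "quotient_norm E y = Inf {norm (y - e) | e. e \<in> E}"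

text \<open>By \<open>norm_at_eq\<close> below, any element of \<open>T `` {x}\<close> may be chosen.\<close>

definition norm_at :: "('a::real_normed_vector \<times> 'b::real_normed_vector) set \<Rightarrow> 'a \<Rightarrow> real"
  where "norm_at T x = quotient_norm (closure (T `` {0})) (SOME y. y \<in> T `` {x})"

definition rel_norm :: "('a::real_normed_vector \<times> 'b::real_normed_vector) set \<Rightarrow> ereal"
  where "rel_norm T = (SUP x\<in>{x \<in> Domain T. norm x \<le> 1}. ereal (norm_at T x))"

definition rel_bounded :: "('a::real_normed_vector \<times> 'b::real_normed_vector) set \<Rightarrow> bool"
  where "rel_bounded T \<longleftrightarrow> rel_norm T < \<infinity>"

lemma LR_iff:
  assumes "normed_space sX" "normed_space sY"
  shows "T \<in> LR sX sY \<longleftrightarrow>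
    (0, 0) \<in> T \<and>
    (\<forall>x y x' y'. (x, y) \<in> T \<longrightarrow> (x', y') \<in> T \<longrightarrow> (x + x', y + y') \<in> T) \<and>
    (\<forall>c x y. (x, y) \<in> T \<longrightarrow> (sX c x, sY c y) \<in> T)"
proof -
  interpret X: normed_space sX by fact
  interpret Y: normed_space sY by fact
  interpret vector_space_prod sX sY ..
  show ?thesis
    by (simp add: LR_def p.subspace_def scale_def zero_prod_def Ball_def)
qed

lemma norm_at_eq:
  assumes "normed_space sX" "normed_space sY" "T \<in> LR sX sY" "y \<in> T `` {x}"
  shows "norm_at T x = quotient_norm (closure (T `` {0})) y"
proof -
  interpret X: normed_space sX by fact
  interpret Y: normed_space sY by fact
  let ?E = "T `` {0}"
  note LR = assms(3)[unfolded LR_iff[OF assms(1,2)]]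
  have diff: "(x - x', y - y') \<in> T" if "(x, y) \<in> T" "(x', y') \<in> T" for x y x' y'
  proof -
    have "(sX (-1) x', sY (-1) y') \<in> T" using LR that(2) by blast
    then have "(x + sX (-1) x', y + sY (-1) y') \<in> T" using LR that(1) by blast
    then show ?thesis by simp
  qed
  have shift: "d + e \<in> closure ?E" if "d \<in> ?E" "e \<in> closure ?E" for d e
  proof -
    have "(+) d ` ?E \<subseteq> ?E"
    proof clarsimp
      fix e assume "(0, e) \<in> T"
      with LR that(1) have "(0 + 0, d + e) \<in> T" by blast
      then show "(0, d + e) \<in> T" by simp
    qed
    moreover have "(+) d ` closure ?E = closure ((+) d ` ?E)"
      by (rule closure_translation[symmetric])
    ultimately show ?thesis using that(2) closure_mono by blast
  qed
  define z where "z = (SOME y. y \<in> T `` {x})"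
  have z: "z \<in> T `` {x}" unfolding z_def using assms(4) by (rule someI)
  have sub: "{norm (u - e) | e. e \<in> closure ?E} \<subseteq> {norm (v - e) | e. e \<in> closure ?E}"
    if "u \<in> T `` {x}" "v \<in> T `` {x}" for u v
  proof clarify
    fix e assume "e \<in> closure ?E"
    moreover have "v - u \<in> ?E" using diff[of x v x u] that by simp
    ultimately have "(v - u) + e \<in> closure ?E" by (intro shift)
    moreover have "norm (u - e) = norm (v - ((v - u) + e))" by simp
    ultimately show "\<exists>e'. norm (u - e) = norm (v - e') \<and> e' \<in> closure ?E" by blast
  qed
  have "quotient_norm (closure ?E) z = quotient_norm (closure ?E) y"
    unfolding quotient_norm_def
    by (intro arg_cong[where f = Inf] equalityI sub z assms(4))
  then show ?thesis by (simp add: norm_at_def z_def)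
qed

end

theory Submission
  imports Defs
begin

text \<open>
  Boundedness of \<open>T\<close> with finite norm \<open>K\<close> says that the distance from \<open>y\<close> to \<open>closure (T `` {0})\<close>
  is at most \<open>K * norm x\<close> for every pair \<open>(x, y)\<close> in \<open>T\<close> (\<open>infdist_value_le\<close>). Both sides of this
  inequality are continuous in \<open>(x, y)\<close>, so it persists on \<open>closure T\<close>
  (\<open>infdist_closure_value_le\<close>), and everything else is a consequence.

  At \<open>x = 0\<close> the inequality on \<open>closure T\<close> says that a value of \<open>closure T\<close> at zero has distance
  zero from \<open>T `` {0}\<close>; if that set is closed, the closure has acquired no new value at zero. Since
  the values of a linear relation at a point form a coset of its values at zero, the closure has
  acquired no new value at any point of the domain, which is closability. It also means that the
  quotient by which \<open>norm_at\<close> measures values is the same for \<open>closure T\<close> as for \<open>T\<close>, so the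
  inequality on \<open>closure T\<close> bounds its norm by \<open>K\<close>. The reverse estimate holds because
  \<open>closure T\<close> has the same values on the smaller domain.

  Completeness enters only in enlarging the domain. Along a sequence of domain points converging
  geometrically fast, each new value can be chosen within its coset so close to the previous one
  that the values form a Cauchy sequence (\<open>closure_Domain_subset\<close>).
\<close>

section \<open>Linear relations and their closures\<close>

lemma LR_zero:
  assumes "normed_space sX" "normed_space sY" "T \<in> LR sX sY"
  shows "(0, 0) \<in> T"
  using assms(3-) unfolding LR_iff[OF assms(1,2)] by blast

lemma LR_add:
  assumes "normed_space sX" "normed_space sY" "T \<in> LR sX sY" "(x, y) \<in> T" "(x', y') \<in> T"
  shows "(x + x', y + y') \<in> T"
  using assms(3-) unfolding LR_iff[OF assms(1,2)] by blast

lemma LR_scale: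
  assumes "normed_space sX" "normed_space sY" "T \<in> LR sX sY" "(x, y) \<in> T"
  shows "(sX c x, sY c y) \<in> T"
  using assms(3-) unfolding LR_iff[OF assms(1,2)] by blast

lemma LR_scaleR:
  assumes "normed_space sX" "normed_space sY" "T \<in> LR sX sY" "(x, y) \<in> T"
  shows "(r *\<^sub>R x, r *\<^sub>R y) \<in> T"
  using LR_scale[OF assms, of "of_real r"] assms(1,2)
  by (simp add: normed_space.scale_of_real)

lemma LR_diff:
  assumes "normed_space sX" "normed_space sY" "T \<in> LR sX sY" "(x, y) \<in> T" "(x', y') \<in> T"
  shows "(x - x', y - y') \<in> T"
  using LR_add[OF assms(1-4) LR_scaleR[OF assms(1-3,5), of "-1"]] by simp

lemma normed_space_bounded_linear_scale:
  assumes "normed_space s"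
  shows "bounded_linear (s c)"
proof -
  interpret normed_space s by fact
  show ?thesis
  proof (rule bounded_linear_intro[where K = "norm c"])
    show "s c (r *\<^sub>R x) = r *\<^sub>R s c x" for r x
      unfolding scale_of_real[symmetric] by (rule scale_left_commute)
  qed (simp_all add: scale_right_distrib norm_scale mult.commute)
qed

lemma closure_LR:
  assumes X: "normed_space sX" and Y: "normed_space sY" and T: "T \<in> LR sX sY"
  shows "closure T \<in> LR sX sY"
  unfolding LR_iff[OF X Y]
proof (intro conjI allI impI)
  show "(0, 0) \<in> closure T"
    using LR_zero[OF X Y T] closure_subset by blast
next
  fix x y x' y'
  assume "(x, y) \<in> closure T" "(x', y') \<in> closure T"
  then obtain p q where p: "\<And>n. p n \<in> T" "p \<longlonglongrightarrow> (x, y)"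
    and q: "\<And>n. q n \<in> T" "q \<longlonglongrightarrow> (x', y')"
    unfolding closure_sequential by blast
  have "p n + q n \<in> T" for n
    using LR_add[OF X Y T, of "fst (p n)" "snd (p n)" "fst (q n)" "snd (q n)"] p(1) q(1)
    by (simp add: plus_prod_def)
  moreover have "(\<lambda>n. p n + q n) \<longlonglongrightarrow> (x + x', y + y')"
    using tendsto_add[OF p(2) q(2)] by simp
  ultimately show "(x + x', y + y') \<in> closure T"
    unfolding closure_sequential by (intro exI[of _ "\<lambda>n. p n + q n"]) simp
next
  fix c x y
  assume xy: "(x, y) \<in> closure T"
  let ?s = "\<lambda>p. (sX c (fst p), sY c (snd p))"
  have "bounded_linear ?s"
    by (intro bounded_linear_Pair
        bounded_linear_compose[OF normed_space_bounded_linear_scale[OF X] bounded_linear_fst]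
        bounded_linear_compose[OF normed_space_bounded_linear_scale[OF Y] bounded_linear_snd])
  then have "continuous_on (closure T) ?s"
    by (rule linear_continuous_on)
  moreover have "?s ` T \<subseteq> closure T"
  proof (rule image_subsetI)
    fix p assume "p \<in> T"
    then have "?s p \<in> T" using LR_scale[OF X Y T, of "fst p" "snd p"] by simp
    then show "?s p \<in> closure T" using closure_subset by blast
  qed
  ultimately have "?s ` closure T \<subseteq> closure T"
    by (intro image_closure_subset closed_closure)
  from subsetD[OF this imageI[OF xy]] show "(sX c x, sY c y) \<in> closure T" by simp
qed

section \<open>The norm of a linear relation as a distance estimate\<close>

lemma quotient_norm_eq_infdist:
  assumes "E \<noteq> {}"
  shows "quotient_norm E y = infdist y E"
  using assms by (simp add: quotient_norm_def infdist_def dist_norm Setcompr_eq_image)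

text \<open>
  Written as a distance, the norm of \<open>T\<close> at a point is a continuous function of the chosen value
  \<open>y\<close>, vanishes only for \<open>y\<close> in the closed set \<open>closure (T `` {0})\<close>, and is approached by elements of
  that set.
\<close>

lemma norm_at_eq_infdist:
  assumes "normed_space sX" "normed_space sY" "T \<in> LR sX sY" "(x, y) \<in> T"
  shows "norm_at T x = infdist y (closure (T `` {0}))"
proof -
  have "closure (T `` {0}) \<noteq> {}"
    using LR_zero[OF assms(1-3)] closure_subset by fastforce
  then show ?thesis
    using norm_at_eq[OF assms(1-3), of y x] assms(4) by (simp add: quotient_norm_eq_infdist)
qed

lemma rel_norm_nonneg:
  assumes "normed_space sX" "normed_space sY" "T \<in> LR sX sY"
  shows "0 \<le> rel_norm T"
  unfolding rel_norm_def
proof (rule SUP_upper2)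
  show "0 \<in> {x \<in> Domain T. norm x \<le> 1}"
    using LR_zero[OF assms] by auto
  show "0 \<le> ereal (norm_at T 0)"
    using norm_at_eq_infdist[OF assms LR_zero[OF assms]] by (simp add: infdist_nonneg)
qed

text \<open>
  The supremum over the unit ball controls every point by homogeneity: a pair with nonzero \<open>x\<close> is
  divided by \<open>norm x\<close>, and the distance scales because \<open>closure (T `` {0})\<close> is a subspace. If \<open>x\<close>
  is zero, \<open>y\<close> lies in \<open>T `` {0}\<close> and its distance is zero.
\<close>

lemma infdist_value_le:
  assumes X: "normed_space sX" and Y: "normed_space sY" and T: "T \<in> LR sX sY"
    and K: "rel_norm T \<le> ereal K" and xy: "(x, y) \<in> T"
  shows "infdist y (closure (T `` {0})) \<le> K * norm x"
proof (cases "x = 0")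
  case True
  then have "y \<in> closure (T `` {0})"
    using xy closure_subset by blast
  then show ?thesis using True by simp
next
  case False
  define n where "n = norm x"
  let ?E = "closure (T `` {0})"
  have n: "n > 0" using False by (simp add: n_def)
  have mem: "(x /\<^sub>R n, y /\<^sub>R n) \<in> T"
    by (rule LR_scaleR[OF X Y T xy])
  have "x /\<^sub>R n \<in> {x \<in> Domain T. norm x \<le> 1}"
    using mem n by (auto simp: n_def)
  then have "ereal (norm_at T (x /\<^sub>R n)) \<le> ereal K"
    using K unfolding rel_norm_def SUP_le_iff by blast
  then have unit: "infdist (y /\<^sub>R n) ?E \<le> K"
    using norm_at_eq_infdist[OF X Y T mem] by simp
  have E: "?E \<noteq> {}"
    using LR_zero[OF X Y T] closure_subset by fastforce
  have scaleE: "n *\<^sub>R e \<in> ?E" if "e \<in> ?E" for e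
  proof -
    have "(*\<^sub>R) n ` ?E \<subseteq> ?E"
    proof (rule image_closure_subset)
      show "(*\<^sub>R) n ` (T `` {0}) \<subseteq> ?E"
        using LR_scaleR[OF X Y T, of 0 _ n] closure_subset[of "T `` {0}"] by fastforce
    qed (intro continuous_intros closed_closure)+
    then show ?thesis using that by blast
  qed
  have "infdist y ?E / n \<le> dist (y /\<^sub>R n) e" if "e \<in> ?E" for e
  proof -
    have "infdist y ?E \<le> norm (y - n *\<^sub>R e)"
      using infdist_le[OF scaleE[OF that]] by (simp add: dist_norm)
    also have "y - n *\<^sub>R e = n *\<^sub>R (y /\<^sub>R n - e)"
      using n by (simp add: scaleR_diff_right)
    also have "norm \<dots> = n * dist (y /\<^sub>R n) e"
      using n by (simp add: dist_norm)
    finally show ?thesis using n by (simp add: field_simps)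
  qed
  then have "infdist y ?E / n \<le> infdist (y /\<^sub>R n) ?E"
    unfolding infdist_notempty[OF E] by (intro cINF_greatest E) auto
  with unit have "infdist y ?E / n \<le> K" by linarith
  with n show ?thesis by (simp add: pos_divide_le_eq n_def)
qed

lemma infdist_closure_value_le:
  assumes "normed_space sX" "normed_space sY" "T \<in> LR sX sY"
    and "rel_norm T \<le> ereal K" and "(x, y) \<in> closure T"
  shows "infdist y (closure (T `` {0})) \<le> K * norm x"
proof -
  let ?B = "{p. infdist (snd p) (closure (T `` {0})) \<le> K * norm (fst p)}"
  have "closed ?B"
    by (intro closed_Collect_le continuous_intros)
  moreover have "T \<subseteq> ?B"
    using infdist_value_le[OF assms(1-4)] by auto
  ultimately have "closure T \<subseteq> ?B"
    by (rule closure_minimal[rotated])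
  then show ?thesis using assms(5) by auto
qed

section \<open>Closability\<close>

lemma closure_Image_zero:
  assumes "normed_space sX" "normed_space sY" "T \<in> LR sX sY"
    and "rel_norm T \<le> ereal K" and "closed (T `` {0})"
  shows "closure T `` {0} = T `` {0}"
proof
  show "closure T `` {0} \<subseteq> T `` {0}"
  proof
    fix y assume "y \<in> closure T `` {0}"
    then have "infdist y (T `` {0}) \<le> 0"
      using infdist_closure_value_le[OF assms(1-4), of 0 y] assms(5) by simp
    moreover have "T `` {0} \<noteq> {}"
      using LR_zero[OF assms(1-3)] by blast
    ultimately show "y \<in> T `` {0}"
      using in_closed_iff_infdist_zero[OF assms(5)] infdist_nonneg[of y "T `` {0}"] by simp
  qed
qed (use closure_subset in blast)

text \<open>
  Two values at the same point differ by a value at zero, so a closure without new values at zero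
  has no new values at any point of the domain.
\<close>

lemma closable_if_closure_Image_zero:
  assumes X: "normed_space sX" and Y: "normed_space sY" and T: "T \<in> LR sX sY"
    and zero: "closure T `` {0} = T `` {0}"
  shows "closable T"
  unfolding closable_def
proof (intro ballI equalityI subsetI)
  fix x y'
  assume "x \<in> Domain T" "y' \<in> closure T `` {x}"
  then obtain y where y: "(x, y) \<in> T" and y': "(x, y') \<in> closure T" by blast
  have "(x - x, y' - y) \<in> closure T"
    using LR_diff[OF X Y closure_LR[OF X Y T] y'] y closure_subset by blast
  then have "(0, y' - y) \<in> T" using zero by auto
  from LR_add[OF X Y T y this] show "y' \<in> T `` {x}" by simp
qed (use closure_subset in blast)

section \<open>The domain of the closure\<close>

lemma Cauchy_if_geometric_steps:
  fixes f :: "nat \<Rightarrow> 'a::metric_space"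
  assumes step: "\<And>n. dist (f (Suc n)) (f n) \<le> C * (1/2) ^ n"
  shows "Cauchy f"
proof -
  have C: "0 \<le> C" using order_trans[OF zero_le_dist step[of 0]] by simp
  have tail: "dist (f (m + k)) (f m) \<le> 2 * C * ((1/2) ^ m - (1/2) ^ (m + k))" for m k
  proof (induction k)
    case (Suc k)
    have "dist (f (m + Suc k)) (f m) \<le> dist (f (Suc (m + k))) (f (m + k)) + dist (f (m + k)) (f m)"
      by (simp add: dist_triangle)
    also have "\<dots> \<le> C * (1/2) ^ (m + k) + 2 * C * ((1/2) ^ m - (1/2) ^ (m + k))"
      by (intro add_mono step Suc.IH)
    also have "\<dots> = 2 * C * ((1/2) ^ m - (1/2) ^ (m + Suc k))"
      by (simp add: algebra_simps)
    finally show ?case .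
  qed simp
  have bound: "dist (f n) (f m) \<le> 2 * C * (1/2) ^ m" if "m \<le> n" for m n
  proof -
    have "dist (f n) (f m) \<le> 2 * C * ((1/2) ^ m - (1/2) ^ n)"
      using tail[of m "n - m"] that by simp
    also have "\<dots> \<le> 2 * C * (1/2) ^ m"
      using C by (intro mult_left_mono) auto
    finally show ?thesis .
  qed
  have lim: "(\<lambda>m. 2 * C * (1/2) ^ m) \<longlonglongrightarrow> 0"
    by (intro tendsto_mult_right_zero LIMSEQ_power_zero) simp
  show ?thesis
    unfolding Cauchy_altdef
  proof (intro allI impI)
    fix e :: real assume "0 < e"
    then obtain M where M: "\<And>m. m \<ge> M \<Longrightarrow> 2 * C * (1/2) ^ m < e"
      using order_tendstoD(2)[OF lim] unfolding eventually_sequentially by blast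
    have "dist (f m) (f n) < e" if "m \<ge> M" "n > m" for m n
      using le_less_trans[OF bound[of m n] M[OF that(1)]] that by (simp add: dist_commute)
    then show "\<exists>M. \<forall>m\<ge>M. \<forall>n>m. dist (f m) (f n) < e" by blast
  qed
qed

text \<open>
  For any value \<open>y'\<close> at \<open>x'\<close>, the difference \<open>y' - y\<close> is a value at \<open>x' - x\<close> and so lies within
  \<open>K * dist x' x\<close> of \<open>T `` {0}\<close>. Subtracting a nearly closest element of \<open>T `` {0}\<close> from \<open>y'\<close> keeps it a
  value at \<open>x'\<close> and brings it near \<open>y\<close>. The slack \<open>e\<close> is there because a closest element need not
  exist.
\<close>

lemma exists_near_value:
  assumes X: "normed_space sX" and Y: "normed_space sY" and T: "T \<in> LR sX sY"
    and K: "rel_norm T \<le> ereal K" and xy: "(x, y) \<in> T" and x': "x' \<in> Domain T"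
    and closed: "closed (T `` {0})" and e: "0 < e"
  shows "\<exists>y'. (x', y') \<in> T \<and> dist y' y < K * dist x' x + e"
proof -
  obtain y' where y': "(x', y') \<in> T" using x' by blast
  have "infdist (y' - y) (T `` {0}) \<le> K * dist x' x"
    using infdist_value_le[OF X Y T K LR_diff[OF X Y T y' xy]] closed by (simp add: dist_norm)
  then have "infdist (y' - y) (T `` {0}) < K * dist x' x + e" using e by linarith
  moreover have "T `` {0} \<noteq> {}" using LR_zero[OF X Y T] by blast
  ultimately obtain d where d: "d \<in> T `` {0}" "dist (y' - y) d < K * dist x' x + e"
    by (auto simp: infdist_notempty cINF_less_iff)
  have "(x' - 0, y' - d) \<in> T" using LR_diff[OF X Y T y'] d(1) by blast
  moreover have "dist (y' - d) y = dist (y' - y) d"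
    by (simp add: dist_norm algebra_simps)
  ultimately show ?thesis using d(2) by (intro exI[of _ "y' - d"]) simp
qed

lemma Domain_closure_subset: "Domain (closure T) \<subseteq> closure (Domain T)"
  for T :: "('a::metric_space \<times> 'b::metric_space) set"
proof -
  have "fst ` closure T \<subseteq> closure (fst ` T)"
    by (intro image_closure_subset closed_closure closure_subset continuous_intros)
  then show ?thesis by (simp add: Domain_fst)
qed

text \<open>
  A limit \<open>x\<close> of domain points is approached at rate \<open>(1/2) ^ n\<close>, so that consecutive points are at
  most \<open>2 * (1/2) ^ n\<close> apart. Choosing each value near the preceding one with slack \<open>(1/2) ^ n\<close>
  makes consecutive values at most \<open>(2 * K + 1) * (1/2) ^ n\<close> apart; completeness gives them a limit,
  which is a value of the closure at \<open>x\<close>.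
\<close>

lemma closure_Domain_subset:
  fixes T :: "('a::real_normed_vector \<times> 'b::real_normed_vector) set"
  assumes X: "normed_space sX" and Y: "normed_space sY" and T: "T \<in> LR sX sY"
    and K: "rel_norm T \<le> ereal K" "0 \<le> K" and closed: "closed (T `` {0})"
    and complete: "complete (UNIV :: 'b set)"
  shows "closure (Domain T) \<subseteq> Domain (closure T)"
proof
  fix x assume x: "x \<in> closure (Domain T)"
  let ?P = "\<lambda>n p. p \<in> T \<and> dist (fst p) x < (1/2) ^ n"
  let ?Q = "\<lambda>n p q. dist (snd q) (snd p) \<le> (2 * K + 1) * (1/2) ^ n"
  have approx: "\<exists>x'\<in>Domain T. dist x' x < (1/2) ^ n" for n :: nat
    using x unfolding closure_approachable by simp
  have "\<exists>p. \<forall>n. ?P n (p n) \<and> ?Q n (p n) (p (Suc n))"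
  proof (rule dependent_nat_choice)
    obtain x' where "x' \<in> Domain T" "dist x' x < (1/2) ^ 0" using approx by blast
    then show "\<exists>p. ?P 0 p" by force
  next
    fix p n assume p: "?P n p"
    obtain x' where x': "x' \<in> Domain T" "dist x' x < (1/2) ^ Suc n" using approx by blast
    obtain y' where y': "(x', y') \<in> T"
      "dist y' (snd p) < K * dist x' (fst p) + (1/2) ^ n"
      using exists_near_value[OF X Y T K(1) _ x'(1) closed, of "fst p" "snd p" "(1/2) ^ n"] p
      by auto
    have near: "dist x' x \<le> (1/2) ^ n"
      using x'(2) zero_le_dist[of x' x] unfolding power_Suc by linarith
    have "dist x' (fst p) \<le> dist x' x + dist (fst p) x"
      by (rule dist_triangle2)
    also have "\<dots> \<le> (1/2) ^ n + (1/2) ^ n"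
      using p near by (intro add_mono) auto
    finally have "K * dist x' (fst p) \<le> K * ((1/2) ^ n + (1/2) ^ n)"
      using K(2) by (rule mult_left_mono)
    then have "dist y' (snd p) \<le> (2 * K + 1) * (1/2) ^ n"
      using y'(2) by (simp add: algebra_simps)
    then show "\<exists>q. ?P (Suc n) q \<and> ?Q n p q"
      using x'(2) y'(1) by (intro exI[of _ "(x', y')"]) simp
  qed
  then obtain p where P: "\<And>n. ?P n (p n)" and Q: "\<And>n. ?Q n (p n) (p (Suc n))" by blast
  have "Cauchy (\<lambda>n. snd (p n))"
    using Q by (rule Cauchy_if_geometric_steps)
  then obtain y where y: "(\<lambda>n. snd (p n)) \<longlonglongrightarrow> y"
    using complete unfolding complete_def by blast
  have "(\<lambda>n. dist (fst (p n)) x) \<longlonglongrightarrow> 0"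
  proof (rule tendsto_sandwich[OF _ _ tendsto_const])
    show "(\<lambda>n. (1/2::real) ^ n) \<longlonglongrightarrow> 0" by (rule LIMSEQ_power_zero) simp
    show "\<forall>\<^sub>F n in sequentially. dist (fst (p n)) x \<le> (1/2) ^ n"
      using P less_imp_le by (intro always_eventually allI) blast
  qed simp
  then have "(\<lambda>n. fst (p n)) \<longlonglongrightarrow> x" by (rule tendsto_dist_iff[THEN iffD2])
  from tendsto_Pair[OF this y] have "p \<longlonglongrightarrow> (x, y)" by simp
  then have "(x, y) \<in> closure T"
    using P unfolding closure_sequential by (intro exI[of _ p]) simp
  then show "x \<in> Domain (closure T)" by blast
qed

section \<open>The norm of the closure\<close>

text \<open>
  That \<open>T `` {0}\<close> is closed makes both norms measure values modulo the same subspace, so the norm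
  of \<open>T\<close> bounds the values of \<open>closure T\<close> at all points of the larger domain.
\<close>

lemma rel_norm_closure:
  assumes X: "normed_space sX" and Y: "normed_space sY" and T: "T \<in> LR sX sY"
    and K: "rel_norm T = ereal K" "0 \<le> K" and closed: "closed (T `` {0})"
  shows "rel_norm (closure T) = rel_norm T"
proof (rule antisym)
  have zero: "closure T `` {0} = T `` {0}"
    using closure_Image_zero[OF X Y T _ closed, of K] K(1) by simp
  show "rel_norm (closure T) \<le> rel_norm T"
    unfolding K(1) rel_norm_def[of "closure T"]
  proof (rule SUP_least)
    fix x assume "x \<in> {x \<in> Domain (closure T). norm x \<le> 1}"
    then obtain y where y: "(x, y) \<in> closure T" and x: "norm x \<le> 1" by blast
    have "norm_at (closure T) x = infdist y (closure (T `` {0}))"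
      using norm_at_eq_infdist[OF X Y closure_LR[OF X Y T] y] zero by simp
    also have "\<dots> \<le> K * norm x"
      by (rule infdist_closure_value_le[OF X Y T _ y]) (simp add: K(1))
    also have "\<dots> \<le> K" using x K(2) by (simp add: mult_left_le)
    finally show "ereal (norm_at (closure T) x) \<le> ereal K" by simp
  qed
  have "norm_at (closure T) x = norm_at T x" if "x \<in> Domain T" for x
    using closable_if_closure_Image_zero[OF X Y T zero] that zero
    by (simp add: closable_def norm_at_def)
  then have "rel_norm T = (SUP x\<in>{x \<in> Domain T. norm x \<le> 1}. ereal (norm_at (closure T) x))"
    unfolding rel_norm_def by (intro SUP_cong) auto
  also have "\<dots> \<le> rel_norm (closure T)"
    unfolding rel_norm_def
    by (rule SUP_subset_mono) (use Domain_mono[OF closure_subset[of T]] in blast)+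
  finally show "rel_norm T \<le> rel_norm (closure T)" .
qed

theorem theorem4p4:
  fixes sX :: "'k::real_normed_field \<Rightarrow> 'a::real_normed_vector \<Rightarrow> 'a"
    and sY :: "'k \<Rightarrow> 'b::real_normed_vector \<Rightarrow> 'b"
    and T :: "('a \<times> 'b) set"
  assumes "normed_space sX"
    and "normed_space sY"
    and "T \<in> LR sX sY"
    and "rel_bounded T"
    and "closed (T `` {0})"
  shows "closable T \<and>
    (complete (UNIV :: 'b set) \<longrightarrow>
      Domain (closure T) = closure (Domain T) \<and>
      is_extension sX sY (closure T) T \<and>
      rel_bounded (closure T) \<and>
      rel_norm (closure T) = rel_norm T)"
proof -
  obtain K where K: "rel_norm T = ereal K" "0 \<le> K"
    using assms(4) rel_norm_nonneg[OF assms(1-3)]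
    by (cases "rel_norm T") (auto simp: rel_bounded_def)
  then have le: "rel_norm T \<le> ereal K" by simp
  have closable: "closable T"
    by (rule closable_if_closure_Image_zero[OF assms(1-3)
          closure_Image_zero[OF assms(1-3) le assms(5)]])
  have "is_extension sX sY (closure T) T"
    using closure_LR[OF assms(1-3)] closable closure_subset[of T]
    by (auto simp: is_extension_def closable_def)
  moreover have norm: "rel_norm (closure T) = rel_norm T"
    by (rule rel_norm_closure[OF assms(1-3) K assms(5)])
  moreover have "rel_bounded (closure T)"
    using assms(4) norm by (simp add: rel_bounded_def)
  moreover have "Domain (closure T) = closure (Domain T)"
    if "complete (UNIV :: 'b set)"
    using closure_Domain_subset[OF assms(1-3) le K(2) assms(5) that] Domain_closure_subset
    by (rule subset_antisym[rotated])
  ultimately show ?thesis using closable by blast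
qed

end
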